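(* The map $\varphi$ satisfies $$\varphi(E_{n\delta+\alpha_0})=q^{-2n}(q+q^{-1})^{2n}\,xC^{s}_n,\qquad \varphi(E_{n\delta+\alpha_1})=q^{-2n}(q+q^{-1})^{2n}\,C^{s}_ny$$ for all $n\ge 0$, and $$\varphi(E_{n\delta})=-q^{-2n}(q+q^{-1})^{2n-1}\,C^{s}_n$$ for all $n\ge 1$. Here $xC^{s}_n$ and $C^{s}_ny$ are concatenation (free) products.
   Context: Ground field $\mathbb{F}=\mathbb{Q}(q)$, $q$ an indeterminate; $\{n\}_q=\frac{q^{-n}-(-1)^nq^n}{q+q^{-1}}$. $U_q^{+}=U_q^{+}(C(2)^{(2)})$ is the unital associative $\mathbb{F}$-superalgebra with odd generators $A,B$ and relations $A^3B+\{3\}_qA^2BA-\{3\}_qABA^2-BA^3=0$, $B^3A+\{3\}_qB^2AB-\{3\}_qBAB^2-AB^3=0$. In it define (PBW generators of Damiani type) $E_{\alpha_0}=A$, $E_{\alpha_1}=B$, $E_\delta=q^{-2}BA+AB$, and for $n\ge1$ $$E_{n\delta+\alpha_0}=\frac{[E_{(n-1)\delta+\alpha_0},E_\delta]}{q-q^{-1}},\quad E_{n\delta+\alpha_1}=\frac{[E_\delta,E_{(n-1)\delta+\alpha_1}]}{q-q^{-1}},\quad E_{n\delta}=q^{-2}E_{(n-1)\delta+\alpha_1}A+AE_{(n-1)\delta+\alpha_1},$$ where $[a,b]=ab-(-1)^{|a||b|}ba$ is the super-commutator ($E_{n\delta}$ even, $E_{n\delta+\alpha_i}$ odd, so here $[a,b]=ab-ba$).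 $\mathbb{V}$ is the free associative unital $\mathbb{F}$-algebra on noncommuting $x,y$; words form a basis; the empty word is $1$; juxtaposition denotes concatenation. The $q$-shuffle superproduct $\star$ is the bilinear associative product on $\mathbb{V}$ with $1\star v=v\star1=v$ and, for nontrivial words $u=u_1\cdots u_r$, $v=v_1\cdots v_s$, recursively $$u\star v=u_1\big((u_2\cdots u_r)\star v\big)+(-1)^r v_1\big(u\star(v_2\cdots v_s)\big)q^{\langle u_1,v_1\rangle+\cdots+\langle u_r,v_1\rangle},$$ where $\langle x,x\rangle=\langle y,y\rangle=2$, $\langle x,y\rangle=\langle y,x\rangle=-2$. $\varphi:U_q^+\to(\mathbb{V},\star)$ is the (injective) superalgebra homomorphism with $A\mapsto x$, $B\mapsto y$. Catalan elements: put $\bar x=1$, $\bar y=-1$. A word $a_1\cdots a_m$ is Catalan if $\bar a_1+\cdots+\bar a_m=0$ and $\bar a_1+\cdots+\bar a_i\ge0$ for all $1\le i\le m$. $\mathrm{Cat}_n$ is the set of Catalan words of length $2n$. Define $C^s(1)=1$, and for $n\ge1$, $w\in\mathrm{Cat}_n$, $$C^{s}(w)=\sum_{v\in\mathrm{Cat}_{n-1}}C^{s}(v)\sum_i(-1)^i\{2+2\bar a_1+\cdots+2\bar a_i\}_q,$$ where, for $v=a_1\cdots a_m$ ($m=2n-2$), the inner sum is over the $i$, $0\le i\le m$, such that $w=a_1\cdots a_i\,x\,a_{i+1}\cdots a_m\,y$. Set $C^{s}_n=\sum_{w\in\mathrm{Cat}_n}C^s(w)\,w\in\mathbb{V}$ (so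 $C^s_0=1$, $C^s_1=\{2\}_qxy$). *)

theory Defs
  imports
    "HOL-Library.Poly_Mapping"
    "HOL-Computational_Algebra.Polynomial"
    "HOL-Computational_Algebra.Fraction_Field"
begin

section \<open>The ground field and the free algebra\<close>

type_synonym ground = "rat poly fract"

definition qvar :: ground  (\<open>\<q>\<close>)
  where "\<q> = Fract [:0, 1:] 1"

definition brace :: "int \<Rightarrow> ground"  (\<open>\<lbrace>_\<rbrace>\<close>)
  where "\<lbrace>n\<rbrace> = (\<q> powi (- n) - (- 1) powi n * \<q> powi n) / (\<q> + inverse \<q>)"

text \<open>
  Words form a monoid under concatenation, so that finitely supported functions on words
  carry the convolution product, which is the product of the free associative algebra.
\<close>

instantiation list :: (type) monoid_add
begin

definition zero_list :: "'a list"
  where "zero_list = []"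

definition plus_list :: "'a list \<Rightarrow> 'a list \<Rightarrow> 'a list"
  where "plus_list = (@)"

instance
  by standard (simp_all add: zero_list_def plus_list_def)

end

type_synonym 'a free_alg = "'a list \<Rightarrow>\<^sub>0 ground"

definition word :: "'a list \<Rightarrow> 'a free_alg"
  where "word w = Poly_Mapping.single w 1"

definition scale :: "ground \<Rightarrow> ('b \<Rightarrow>\<^sub>0 ground) \<Rightarrow> ('b \<Rightarrow>\<^sub>0 ground)"
  where "scale c f = Poly_Mapping.map ((*) c) f"

text \<open>The linear map that sends each basis element \<open>k\<close> to \<open>F k\<close>.\<close>

definition extend :: "('b \<Rightarrow> ('c \<Rightarrow>\<^sub>0 ground)) \<Rightarrow> ('b \<Rightarrow>\<^sub>0 ground) \<Rightarrow> ('c \<Rightarrow>\<^sub>0 ground)"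
  where "extend F f = (\<Sum>k\<in>Poly_Mapping.keys f. scale (Poly_Mapping.lookup f k) (F k))"

lemma lookup_scale [simp]: "Poly_Mapping.lookup (scale c f) k = c * Poly_Mapping.lookup f k"
  unfolding scale_def by transfer (simp add: when_def)

interpretation free_alg: vector_space scale
  by standard (auto intro!: poly_mapping_eqI simp: lookup_add algebra_simps)

lemma scale_single [simp]: "scale c (Poly_Mapping.single w d) = Poly_Mapping.single w (c * d)"
  by (rule poly_mapping_eqI) (simp add: lookup_single when_def)

lemma scale_conv_mult: "scale c f = Poly_Mapping.single [] c * f"
  unfolding scale_def mult_map_scale_conv_mult by (simp add: zero_list_def)

lemma single_mult_single:
  "Poly_Mapping.single u c * Poly_Mapping.single v d = Poly_Mapping.single (u @ v) (c * d)"
  by (simp add: mult_single plus_list_def)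

lemma word_mult: "word u * word v = word (u @ v)"
  by (simp add: word_def single_mult_single)

lemma word_Nil: "word [] = 1"
  unfolding word_def zero_list_def[symmetric] by simp

lemma scale_mult_left: "scale c f * g = scale c (f * (g :: 'a free_alg))"
  by (simp add: scale_conv_mult mult.assoc)

lemma extend_superset:
  assumes "finite S" "Poly_Mapping.keys f \<subseteq> S"
  shows "extend F f = (\<Sum>k\<in>S. scale (Poly_Mapping.lookup f k) (F k))"
  unfolding extend_def using assms
  by (intro sum.mono_neutral_left) (auto simp: in_keys_iff)

lemma extend_zero [simp]: "extend F 0 = 0"
  by (simp add: extend_def)

lemma extend_add: "extend F (f + g) = extend F f + extend F g"
proof -
  have "Poly_Mapping.keys (f + g) \<subseteq> Poly_Mapping.keys f \<union> Poly_Mapping.keys g" by (rule keys_add)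
  then show ?thesis
    by (simp add: extend_superset[where S = "Poly_Mapping.keys f \<union> Poly_Mapping.keys g"] lookup_add
        free_alg.scale_left_distrib sum.distrib)
qed

lemma extend_scale: "extend F (scale c f) = scale c (extend F f)"
proof -
  have "Poly_Mapping.keys (scale c f) \<subseteq> Poly_Mapping.keys f" by (auto simp: in_keys_iff)
  then have "extend F (scale c f) = (\<Sum>k\<in>Poly_Mapping.keys f. scale (Poly_Mapping.lookup (scale c f) k) (F k))"
    by (rule extend_superset[OF finite_keys])
  then show ?thesis by (simp add: extend_def free_alg.scale_sum_right)
qed

lemma extend_single [simp]: "extend F (Poly_Mapping.single w c) = scale c (F w)"
  by (cases "c = 0") (simp_all add: extend_def)

lemma extend_word [simp]: "extend F (word w) = F w"
  by (simp add: word_def)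

lemma extend_fun_add: "extend (\<lambda>k. F k + G k) f = extend F f + extend G f"
  by (simp add: extend_def free_alg.scale_right_distrib sum.distrib)

lemma extend_fun_scale: "extend (\<lambda>k. scale c (F k)) f = scale c (extend F f)"
  by (simp add: extend_def free_alg.scale_sum_right mult.commute)

lemma free_alg_induct [case_names zero add word]:
  assumes "P 0" "\<And>f g. P f \<Longrightarrow> P g \<Longrightarrow> P (f + g)"
    "\<And>c w. P (scale c (word w))"
  shows "P (f :: 'b list \<Rightarrow>\<^sub>0 ground)"
proof -
  have "f = (\<Sum>w\<in>Poly_Mapping.keys f. scale (Poly_Mapping.lookup f w) (word w))"
    by (rule poly_mapping_eqI)
      (simp add: lookup_sum word_def lookup_single when_def in_keys_iff)
  moreover have "P (\<Sum>w\<in>S. scale (Poly_Mapping.lookup f w) (word w))" if "finite S" for S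
    using that by (induction S rule: finite_induct) (simp_all add: assms)
  ultimately show ?thesis by (metis finite_keys)
qed

lemma linear_eqI:
  fixes F G :: "'b free_alg \<Rightarrow> 'c free_alg"
  assumes "\<And>f g. F (f + g) = F f + F g" "\<And>c f. F (scale c f) = scale c (F f)"
    "\<And>f g. G (f + g) = G f + G g" "\<And>c f. G (scale c f) = scale c (G f)"
    "\<And>w. F (word w) = G (word w)"
  shows "F f = G f"
proof (induction f rule: free_alg_induct)
  case zero
  have "F (scale 0 0) = G (scale 0 0)" unfolding assms(2,4) by simp
  then show ?case by simp
qed (simp_all add: assms)


section \<open>The superalgebra $U_q^+(C(2)^{(2)})$\<close>

datatype gen = GA | GB

text \<open>
  The Serre-type relator \<open>a\<^sup>3b + {3}a\<^sup>2ba - {3}aba\<^sup>2 - ba\<^sup>3\<close>; the two defining relations are the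
  cases \<open>(a, b) = (A, B)\<close> and \<open>(a, b) = (B, A)\<close>.
\<close>

definition serre_relator :: "gen \<Rightarrow> gen \<Rightarrow> gen free_alg"
  where "serre_relator a b =
    word [a, a, a, b] + scale \<lbrace>3\<rbrace> (word [a, a, b, a])
      - scale \<lbrace>3\<rbrace> (word [a, b, a, a]) - word [b, a, a, a]"

inductive_set serre_ideal :: "gen free_alg set"
  where
    zero: "0 \<in> serre_ideal"
  | relator: "r \<in> {serre_relator GA GB, serre_relator GB GA} \<Longrightarrow> f * r * g \<in> serre_ideal"
  | add: "f \<in> serre_ideal \<Longrightarrow> g \<in> serre_ideal \<Longrightarrow> f + g \<in> serre_ideal"

lemma serre_ideal_mult_left: "f \<in> serre_ideal \<Longrightarrow> h * f \<in> serre_ideal"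
proof (induction rule: serre_ideal.induct)
  case (relator r f g)
  then show ?case
    using serre_ideal.relator[OF relator, of "h * f" g] by (simp only: mult.assoc)
qed (auto simp: distrib_left intro: serre_ideal.intros)

lemma serre_ideal_mult_right: "f \<in> serre_ideal \<Longrightarrow> f * h \<in> serre_ideal"
proof (induction rule: serre_ideal.induct)
  case (relator r f g)
  then show ?case
    using serre_ideal.relator[OF relator, of f "g * h"] by (simp only: mult.assoc)
qed (auto simp: distrib_right intro: serre_ideal.intros)

lemma serre_ideal_uminus: "f \<in> serre_ideal \<Longrightarrow> - f \<in> serre_ideal"
  using serre_ideal_mult_left[of f "- 1"] by simp

lemma serre_ideal_diff: "f \<in> serre_ideal \<Longrightarrow> g \<in> serre_ideal \<Longrightarrow> f - g \<in> serre_ideal"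
  using serre_ideal.add[of f "- g"] serre_ideal_uminus by simp

definition serre_cong :: "gen free_alg \<Rightarrow> gen free_alg \<Rightarrow> bool"
  where "serre_cong f g \<longleftrightarrow> f - g \<in> serre_ideal"

lemma equivp_serre_cong: "equivp serre_cong"
proof (rule equivpI)
  show "reflp serre_cong" by (simp add: reflp_def serre_cong_def serre_ideal.zero)
  show "symp serre_cong"
  proof (rule sympI)
    fix f g assume "serre_cong f g"
    then show "serre_cong g f"
      unfolding serre_cong_def using serre_ideal_uminus[of "f - g"] by (simp only: minus_diff_eq)
  qed
  show "transp serre_cong"
  proof (rule transpI)
    fix f g h assume "serre_cong f g" "serre_cong g h"
    then have "(f - g) + (g - h) \<in> serre_ideal"
      unfolding serre_cong_def by (rule serre_ideal.add)
    then show "serre_cong f h" by (simp add: serre_cong_def)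
  qed
qed

quotient_type uq_plus = "gen free_alg" / serre_cong
  by (rule equivp_serre_cong)

instantiation uq_plus :: ring_1
begin

lift_definition zero_uq_plus :: uq_plus is "0" .
lift_definition one_uq_plus :: uq_plus is "1" .

lift_definition plus_uq_plus :: "uq_plus \<Rightarrow> uq_plus \<Rightarrow> uq_plus" is "(+)"
  unfolding serre_cong_def by (simp only: add_diff_add serre_ideal.add)

lift_definition uminus_uq_plus :: "uq_plus \<Rightarrow> uq_plus" is "uminus"
  unfolding serre_cong_def by (simp only: minus_diff_minus serre_ideal_uminus)

lift_definition minus_uq_plus :: "uq_plus \<Rightarrow> uq_plus \<Rightarrow> uq_plus" is "(-)"
proof -
  fix f f' g g' assume "serre_cong f f'" "serre_cong g g'"
  then have "(f - f') - (g - g') \<in> serre_ideal"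
    unfolding serre_cong_def by (rule serre_ideal_diff)
  then show "serre_cong (f - g) (f' - g')"
    unfolding serre_cong_def by (simp add: algebra_simps)
qed

lift_definition times_uq_plus :: "uq_plus \<Rightarrow> uq_plus \<Rightarrow> uq_plus" is "(*)"
proof -
  fix f f' g g' assume "serre_cong f f'" "serre_cong g g'"
  then have "(f - f') * g + f' * (g - g') \<in> serre_ideal"
    unfolding serre_cong_def
    by (intro serre_ideal.add serre_ideal_mult_left serre_ideal_mult_right)
  then show "serre_cong (f * g) (f' * g')"
    unfolding serre_cong_def by (simp add: algebra_simps)
qed

lemma one_notin_serre_ideal: "1 \<notin> serre_ideal"
proof -
  have "Poly_Mapping.lookup f [] = 0" if "f \<in> serre_ideal" for f
    using that
  proof (induction rule: serre_ideal.induct)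
    case (relator r f g)
    have "[] \<notin> Poly_Mapping.keys (f * r * g)"
    proof
      assume "[] \<in> Poly_Mapping.keys (f * r * g)"
      then obtain a b where ab: "a \<in> Poly_Mapping.keys (f * r)" "[] = a @ b"
        using keys_mult[of "f * r" g] by (auto simp: plus_list_def)
      then have "[] \<in> Poly_Mapping.keys (f * r)" by simp
      then have "[] \<in> Poly_Mapping.keys r"
        using keys_mult[of f r] by (auto simp: plus_list_def)
      then show False
        using relator by (auto simp: serre_relator_def in_keys_iff lookup_add lookup_minus
            word_def lookup_single when_def)
    qed
    then show ?case by (simp add: in_keys_iff)
  qed (simp_all add: lookup_add)
  moreover have "Poly_Mapping.lookup (1 :: gen free_alg) [] \<noteq> 0"
    by (simp add: lookup_one zero_list_def)
  ultimately show ?thesis by blast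
qed

instance
proof
  show "(0 :: uq_plus) \<noteq> 1"
    by transfer (use one_notin_serre_ideal serre_ideal_uminus in \<open>force simp: serre_cong_def\<close>)
qed (transfer, simp add: algebra_simps serre_cong_def serre_ideal.zero)+

end

lift_definition uq_scale :: "ground \<Rightarrow> uq_plus \<Rightarrow> uq_plus" is scale
  unfolding serre_cong_def free_alg.scale_right_diff_distrib[symmetric]
  by (simp add: scale_conv_mult serre_ideal_mult_left)

lift_definition uq_A :: uq_plus is "word [GA]" .
lift_definition uq_B :: uq_plus is "word [GB]" .

interpretation uq_plus: vector_space uq_scale
proof
  fix a b :: ground and x y :: uq_plus
  show "uq_scale a (x + y) = uq_scale a x + uq_scale a y"
    by transfer (simp add: free_alg.scale_right_distrib serre_cong_def serre_ideal.zero)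
  show "uq_scale (a + b) x = uq_scale a x + uq_scale b x"
    by transfer (simp add: free_alg.scale_left_distrib serre_cong_def serre_ideal.zero)
  show "uq_scale a (uq_scale b x) = uq_scale (a * b) x"
    by transfer (simp add: serre_cong_def serre_ideal.zero)
  show "uq_scale 1 x = x"
    by transfer (simp add: serre_cong_def serre_ideal.zero)
qed

lemma uq_scale_mult_left: "uq_scale c a * b = uq_scale c (a * b)"
  by transfer (simp add: scale_mult_left serre_cong_def serre_ideal.zero)

lemma scale_mult_right: "f * scale c g = scale c (f * (g :: 'a free_alg))"
proof (rule linear_eqI[where f = f and F = "\<lambda>f. f * scale c g" and G = "\<lambda>f. scale c (f * g)"])
  fix w
  show "word w * scale c g = scale c (word w * g)"
    by (simp add: word_def scale_conv_mult single_mult_single flip: mult.assoc)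
qed (simp_all add: distrib_right free_alg.scale_right_distrib scale_mult_left mult.commute)

lemma uq_scale_mult_right: "a * uq_scale c b = uq_scale c (a * b)"
  by transfer (simp add: scale_mult_right serre_cong_def serre_ideal.zero)

text \<open>
  The parity involution is \<open>(- 1)\<close> to the parity on homogeneous elements.  Since the ground field
  has characteristic zero, it determines the \<open>\<int>/2\<close>-grading in which \<open>A\<close> and \<open>B\<close> are odd: even and
  odd elements are its eigenvectors for the eigenvalues \<open>1\<close> and \<open>- 1\<close>.
\<close>

definition parity_inv :: "'a free_alg \<Rightarrow> 'a free_alg"
  where "parity_inv = extend (\<lambda>w. Poly_Mapping.single w ((- 1) ^ length w))"

lemma parity_inv_word: "parity_inv (word w) = scale ((- 1) ^ length w) (word w)"
  by (simp add: parity_inv_def word_def)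

lemma parity_inv_zero [simp]: "parity_inv 0 = 0"
  and parity_inv_add: "parity_inv (f + g) = parity_inv f + parity_inv g"
  and parity_inv_scale: "parity_inv (scale c f) = scale c (parity_inv f)"
  by (simp_all add: parity_inv_def extend_add extend_scale)

lemma parity_inv_diff: "parity_inv (f - g) = parity_inv f - parity_inv g"
  using parity_inv_add[of "f - g" g] by simp

lemma parity_inv_mult: "parity_inv (f * g) = parity_inv f * parity_inv g"
proof (rule linear_eqI[where f = f and F = "\<lambda>f. parity_inv (f * g)"])
  fix u
  show "parity_inv (word u * g) = parity_inv (word u) * parity_inv g"
  proof (rule linear_eqI[where f = g and F = "\<lambda>g. parity_inv (word u * g)"])
    fix v
    show "parity_inv (word u * word v) = parity_inv (word u) * parity_inv (word v)"
      by (simp add: word_mult parity_inv_word scale_mult_left scale_mult_right power_add)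
  qed (simp_all add: distrib_left parity_inv_add parity_inv_scale scale_mult_right
      scale_mult_left free_alg.scale_right_distrib)
qed (simp_all add: distrib_right parity_inv_add parity_inv_scale scale_mult_left)

lemma parity_inv_involutive [simp]: "parity_inv (parity_inv f) = f"
proof (rule linear_eqI[where f = f and F = "\<lambda>f. parity_inv (parity_inv f)"])
  show "parity_inv (parity_inv (word w)) = word w" for w :: "'a list"
    by (simp add: parity_inv_word parity_inv_scale flip: power_mult_distrib)
qed (simp_all add: parity_inv_add parity_inv_scale)

lemma parity_inv_serre_ideal: "f \<in> serre_ideal \<Longrightarrow> parity_inv f \<in> serre_ideal"
proof (induction rule: serre_ideal.induct)
  case (relator r f g)
  have "parity_inv (serre_relator a b) = serre_relator a b" for a b
    by (simp add: serre_relator_def parity_inv_add parity_inv_diff parity_inv_scale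
        parity_inv_word)
  then have "parity_inv r = r" using relator by auto
  then show ?case using relator by (simp add: parity_inv_mult serre_ideal.relator)
qed (auto simp: parity_inv_add intro: serre_ideal.intros)

lift_definition uq_parity_inv :: "uq_plus \<Rightarrow> uq_plus" is parity_inv
  unfolding serre_cong_def parity_inv_diff[symmetric] by (rule parity_inv_serre_ideal)

definition uq_even :: "uq_plus \<Rightarrow> bool"
  where "uq_even a \<longleftrightarrow> uq_parity_inv a = a"

definition uq_odd :: "uq_plus \<Rightarrow> bool"
  where "uq_odd a \<longleftrightarrow> uq_parity_inv a = - a"

definition even_part :: "uq_plus \<Rightarrow> uq_plus"
  where "even_part a = uq_scale (1 / 2) (a + uq_parity_inv a)"

definition odd_part :: "uq_plus \<Rightarrow> uq_plus"
  where "odd_part a = uq_scale (1 / 2) (a - uq_parity_inv a)"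

text \<open>
  The bilinear extension of \<open>[a, b] = ab - (- 1)\<^bsup>|a||b|\<^esup>ba\<close> from homogeneous elements: it
  differs from \<open>ab - ba\<close> only on the odd parts, where it is \<open>ab + ba\<close>.
\<close>

definition super_comm :: "uq_plus \<Rightarrow> uq_plus \<Rightarrow> uq_plus"
  where "super_comm a b =
    (a * b - b * a) + 2 * odd_part b * odd_part a"

lemma uq_parity_inv_add: "uq_parity_inv (a + b) = uq_parity_inv a + uq_parity_inv b"
  by transfer (simp add: parity_inv_add serre_cong_def serre_ideal.zero)

lemma uq_parity_inv_scale: "uq_parity_inv (uq_scale c a) = uq_scale c (uq_parity_inv a)"
  by transfer (simp add: parity_inv_scale serre_cong_def serre_ideal.zero)

lemma uq_parity_inv_mult: "uq_parity_inv (a * b) = uq_parity_inv a * uq_parity_inv b"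
  by transfer (simp add: parity_inv_mult serre_cong_def serre_ideal.zero)

lemma uq_parity_inv_involutive [simp]: "uq_parity_inv (uq_parity_inv a) = a"
  by transfer (simp add: serre_cong_def serre_ideal.zero)

lemma uq_odd_A: "uq_odd uq_A" and uq_odd_B: "uq_odd uq_B"
  unfolding uq_odd_def
  by (transfer, simp add: parity_inv_word serre_cong_def serre_ideal.zero)+

lemma uq_scale_half: "uq_scale (1 / 2) (a + a) = a"
proof -
  have "uq_scale (1 / 2) (a + a) = uq_scale (1 / 2 + 1 / 2) a"
    by (simp only: uq_plus.scale_right_distrib uq_plus.scale_left_distrib)
  then show ?thesis by simp
qed

lemma even_part_plus_odd_part: "even_part a + odd_part a = a"
  unfolding even_part_def odd_part_def uq_plus.scale_right_distrib[symmetric]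
  using uq_scale_half[of a] by simp

lemma super_comm_even_left: "uq_even a \<Longrightarrow> super_comm a b = a * b - b * a"
  and super_comm_even_right: "uq_even b \<Longrightarrow> super_comm a b = a * b - b * a"
  by (simp_all add: super_comm_def odd_part_def uq_even_def)

lemma odd_part_odd: "uq_odd a \<Longrightarrow> odd_part a = a"
  by (simp add: odd_part_def uq_odd_def uq_scale_half)

lemma super_comm_odd: "uq_odd a \<Longrightarrow> uq_odd b \<Longrightarrow> super_comm a b = a * b + b * a"
  by (simp add: super_comm_def odd_part_odd mult_2 distrib_right)


section \<open>The PBW generators\<close>

definition E_delta1 :: uq_plus
  where "E_delta1 = uq_scale (\<q> powi (- 2)) (uq_B * uq_A) + uq_A * uq_B"

primrec E_alpha0 :: "nat \<Rightarrow> uq_plus"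
  where
    "E_alpha0 0 = uq_A"
  | "E_alpha0 (Suc n) = uq_scale (inverse (\<q> - inverse \<q>)) (super_comm (E_alpha0 n) E_delta1)"

primrec E_alpha1 :: "nat \<Rightarrow> uq_plus"
  where
    "E_alpha1 0 = uq_B"
  | "E_alpha1 (Suc n) = uq_scale (inverse (\<q> - inverse \<q>)) (super_comm E_delta1 (E_alpha1 n))"

text \<open>
  \<open>E_alpha0 n\<close>, \<open>E_alpha1 n\<close> and, for \<open>n \<ge> 1\<close> only, \<open>E_delta n\<close> stand for
  $E_{n\delta+\alpha_0}$, $E_{n\delta+\alpha_1}$ and $E_{n\delta}$.
\<close>

definition E_delta :: "nat \<Rightarrow> uq_plus"
  where "E_delta n =
    uq_scale (\<q> powi (- 2)) (E_alpha1 (n - 1) * uq_A) + uq_A * E_alpha1 (n - 1)"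

lemma E_delta_1: "E_delta 1 = E_delta1"
  by (simp add: E_delta_def E_delta1_def)

lemma uq_even_E_delta1: "uq_even E_delta1"
  using uq_odd_A uq_odd_B
  by (simp add: uq_even_def uq_odd_def E_delta1_def uq_parity_inv_add uq_parity_inv_scale
      uq_parity_inv_mult)


section \<open>The $q$-shuffle superalgebra\<close>

datatype letter = LX | LY

definition letter_form :: "letter \<Rightarrow> letter \<Rightarrow> int"
  where "letter_form a b = (if a = b then 2 else - 2)"

text \<open>The factor picked up when the letter \<open>b\<close> is moved in front of the word \<open>u\<close>.\<close>

definition braiding :: "letter list \<Rightarrow> letter \<Rightarrow> ground"
  where "braiding u b = (- 1) ^ length u * \<q> powi (\<Sum>a\<leftarrow>u. letter_form a b)"

fun shuffle_word :: "letter list \<Rightarrow> letter list \<Rightarrow> letter free_alg"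
  where
    "shuffle_word [] v = word v"
  | "shuffle_word u [] = word u"
  | "shuffle_word (a # u) (b # v) =
      word [a] * shuffle_word u (b # v)
        + scale (braiding (a # u) b) (word [b] * shuffle_word (a # u) v)"

definition shuffle :: "letter free_alg \<Rightarrow> letter free_alg \<Rightarrow> letter free_alg"
    (infixl \<open>\<star>\<close> 70)
  where "f \<star> g = extend (\<lambda>u. extend (shuffle_word u) g) f"

lemma shuffle_word_Nil_right [simp]: "shuffle_word u [] = word u"
  by (cases u) simp_all

lemma word_shuffle_word: "word u \<star> word v = shuffle_word u v"
  by (simp add: shuffle_def)

lemma shuffle_add_left: "(f + g) \<star> h = f \<star> h + g \<star> h"
  and shuffle_scale_left: "scale c f \<star> h = scale c (f \<star> h)"
  and shuffle_add_right: "h \<star> (f + g) = h \<star> f + h \<star> g"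
  and shuffle_scale_right: "h \<star> scale c f = scale c (h \<star> f)"
  by (simp_all add: shuffle_def extend_add extend_scale extend_fun_add extend_fun_scale)

lemma shuffle_zero_left [simp]: "0 \<star> f = 0" and shuffle_zero_right [simp]: "f \<star> 0 = 0"
  using shuffle_scale_left[of 0 0 f] shuffle_scale_right[of f 0 0] by simp_all

lemma shuffle_minus_left: "- f \<star> g = - (f \<star> g)"
  using shuffle_scale_left[of "- 1" f g] by simp

lemmas shuffle_linear =
  shuffle_add_left shuffle_scale_left shuffle_add_right shuffle_scale_right

lemmas free_alg_linear =
  distrib_left distrib_right scale_mult_left scale_mult_right free_alg.scale_right_distrib

lemma shuffle_one_left [simp]: "1 \<star> f = f"
  by (rule linear_eqI[where f = f and F = "(\<star>) 1"])
    (simp_all add: shuffle_linear word_shuffle_word flip: word_Nil)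

lemma shuffle_one_right [simp]: "f \<star> 1 = f"
  by (rule linear_eqI[where f = f and F = "\<lambda>f. f \<star> 1"])
    (simp_all add: shuffle_linear word_shuffle_word flip: word_Nil)

lemma qvar_nonzero [simp]: "\<q> \<noteq> 0"
  by (simp add: qvar_def Zero_fract_def eq_fract)

lemma braiding_append: "braiding (u @ v) b = braiding u b * braiding v b"
  by (simp add: braiding_def power_add power_int_add)

definition twist :: "letter \<Rightarrow> letter free_alg \<Rightarrow> letter free_alg"
  where "twist b = extend (\<lambda>w. scale (braiding w b) (word w))"

lemma twist_word: "twist b (word w) = scale (braiding w b) (word w)"
  and twist_add: "twist b (f + g) = twist b f + twist b g"
  and twist_scale: "twist b (scale c f) = scale c (twist b f)"
  by (simp_all add: twist_def extend_add extend_scale)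

lemma twist_word_mult: "twist b (word u * f) = scale (braiding u b) (word u * twist b f)"
  by (rule linear_eqI[where f = f and F = "\<lambda>f. twist b (word u * f)"])
    (simp_all add: free_alg_linear twist_add twist_scale twist_word word_mult braiding_append
      mult.commute)

lemma twist_shuffle_word:
  "twist c (shuffle_word u v) = scale (braiding u c * braiding v c) (shuffle_word u v)"
proof (induction u v rule: shuffle_word.induct)
  case (1 v)
  then show ?case by (simp add: twist_word braiding_def)
next
  case (2 a u)
  then show ?case by (simp add: twist_word braiding_def)
next
  case (3 a u b v)
  have *: "braiding (d # w) c = braiding [d] c * braiding w c" for d w
    using braiding_append[of "[d]" w c] by simp
  show ?case
    by (simp add: twist_add twist_scale twist_word_mult 3 free_alg_linear)
      (simp add: *[of a u] *[of b v] ac_simps)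
qed

lemma shuffle_Cons:
  "(word [a] * f) \<star> (word [b] * g) =
    word [a] * (f \<star> (word [b] * g)) + word [b] * (twist b (word [a] * f) \<star> g)"
proof (rule linear_eqI[where f = f and F = "\<lambda>f. (word [a] * f) \<star> (word [b] * g)"])
  fix u
  show "(word [a] * word u) \<star> (word [b] * g) =
    word [a] * (word u \<star> (word [b] * g)) + word [b] * (twist b (word [a] * word u) \<star> g)"
  proof (rule linear_eqI[where f = g and F = "\<lambda>g. (word [a] * word u) \<star> (word [b] * g)"])
    fix v
    show "(word [a] * word u) \<star> (word [b] * word v) =
      word [a] * (word u \<star> (word [b] * word v))
        + word [b] * (twist b (word [a] * word u) \<star> word v)"
      by (simp add: word_mult word_shuffle_word twist_word shuffle_linear free_alg_linear)
  qed (simp_all add: free_alg_linear shuffle_linear)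
qed (simp_all add: free_alg_linear shuffle_linear twist_add twist_scale)

lemma shuffle_word_assoc: "shuffle_word u v \<star> word w = word u \<star> shuffle_word v w"
proof (induction "length u + length v + length w" arbitrary: u v w rule: less_induct)
  case less
  consider "u = []" | "v = []" | "w = []"
    | a u' b v' c w' where "u = a # u'" "v = b # v'" "w = c # w'"
    by (metis list.exhaust)
  then show ?case
  proof cases
    case (4 a u' b v' c w')
    let ?u = "word (a # u')" and ?v = "word (b # v')" and ?w = "word (c # w')"
    have split: "word (d # x) = word [d] * word x" for d :: letter and x
      by (simp add: word_mult)
    have IH1: "shuffle_word u' (b # v') \<star> ?w = word u' \<star> shuffle_word (b # v') (c # w')"
      and IH2: "shuffle_word (a # u') v' \<star> ?w = ?u \<star> shuffle_word v' (c # w')"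
      and IH3: "shuffle_word (a # u') (b # v') \<star> word w' = ?u \<star> shuffle_word (b # v') w'"
      using less[of u' v w] less[of u v' w] less[of u v w'] unfolding 4
      by (simp_all del: shuffle_word.simps)
    let ?ab = "braiding (a # u') b" and ?ac = "braiding (a # u') c"
      and ?bc = "braiding (b # v') c"
    have "shuffle_word u v \<star> word w =
        (word [a] * shuffle_word u' (b # v')) \<star> (word [c] * word w')
        + scale ?ab ((word [b] * shuffle_word (a # u') v') \<star> (word [c] * word w'))"
      unfolding 4 by (simp add: shuffle_linear word_mult)
    also have "\<dots> = word [a] * (shuffle_word u' (b # v') \<star> ?w)
        + scale ?ab (word [b] * (shuffle_word (a # u') v' \<star> ?w))
        + word [c] * (twist c (shuffle_word (a # u') (b # v')) \<star> word w')"
      by (simp only: shuffle_Cons shuffle_word.simps twist_add twist_scale shuffle_linear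
          free_alg_linear) (simp add: word_mult add_ac)
    also have "\<dots> = word [a] * (word u' \<star> shuffle_word (b # v') (c # w'))
        + scale ?ab (word [b] * (?u \<star> shuffle_word v' (c # w')))
        + scale (?ac * ?bc) (word [c] * (?u \<star> shuffle_word (b # v') w'))"
      by (simp only: twist_shuffle_word shuffle_linear free_alg_linear IH1 IH2 IH3)
    also have "\<dots> = ((word [a] * word u') \<star> (word [b] * shuffle_word v' (c # w')))
        + scale ?bc ((word [a] * word u') \<star> (word [c] * shuffle_word (b # v') w'))"
      by (simp only: shuffle_Cons shuffle_word.simps shuffle_linear free_alg_linear)
        (simp add: word_mult twist_word shuffle_linear free_alg_linear ac_simps)
    also have "\<dots> = word u \<star> shuffle_word v w"
      unfolding 4 by (simp add: shuffle_linear word_mult)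
    finally show ?thesis .
  qed (simp_all add: word_shuffle_word word_Nil)
qed

lemma shuffle_assoc: "(f \<star> g) \<star> h = f \<star> (g \<star> h)"
proof (rule linear_eqI[where f = f and F = "\<lambda>f. (f \<star> g) \<star> h"])
  fix u
  show "(word u \<star> g) \<star> h = word u \<star> (g \<star> h)"
  proof (rule linear_eqI[where f = g and F = "\<lambda>g. (word u \<star> g) \<star> h"])
    fix v
    show "(word u \<star> word v) \<star> h = word u \<star> (word v \<star> h)"
      by (rule linear_eqI[where f = h and F = "\<lambda>h. (word u \<star> word v) \<star> h"])
        (simp_all add: shuffle_linear word_shuffle_word shuffle_word_assoc)
  qed (simp_all add: shuffle_linear)
qed (simp_all add: shuffle_linear)

lemma parity_inv_shuffle: "parity_inv (f \<star> g) = parity_inv f \<star> parity_inv g"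
proof -
  have *: "parity_inv (shuffle_word u v) =
      scale ((- 1) ^ (length u + length v)) (shuffle_word u v)" for u v
    by (induction u v rule: shuffle_word.induct)
      (simp_all add: parity_inv_word parity_inv_add parity_inv_scale parity_inv_mult
        free_alg_linear mult.commute)
  show ?thesis
  proof (rule linear_eqI[where f = f and F = "\<lambda>f. parity_inv (f \<star> g)"])
    fix u
    show "parity_inv (word u \<star> g) = parity_inv (word u) \<star> parity_inv g"
      by (rule linear_eqI[where f = g and F = "\<lambda>g. parity_inv (word u \<star> g)"])
        (simp_all add: * shuffle_linear parity_inv_word parity_inv_add parity_inv_scale
          word_shuffle_word free_alg.scale_right_distrib power_add mult.commute)
  qed (simp_all add: shuffle_linear parity_inv_add parity_inv_scale)
qed


section \<open>The homomorphism from $U_q^+$ to the $q$-shuffle superalgebra\<close>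

fun gen_image :: "gen \<Rightarrow> letter free_alg"
  where
    "gen_image GA = word [LX]"
  | "gen_image GB = word [LY]"

definition free_phi :: "gen free_alg \<Rightarrow> letter free_alg"
  where "free_phi = extend (\<lambda>w. foldr (\<lambda>a f. gen_image a \<star> f) w 1)"

lemma free_phi_word: "free_phi (word w) = foldr (\<lambda>a f. gen_image a \<star> f) w 1"
  and free_phi_zero: "free_phi 0 = 0"
  and free_phi_add: "free_phi (f + g) = free_phi f + free_phi g"
  and free_phi_scale: "free_phi (scale c f) = scale c (free_phi f)"
  by (simp_all add: free_phi_def extend_add extend_scale)

lemma free_phi_diff: "free_phi (f - g) = free_phi f - free_phi g"
  using free_phi_add[of "f - g" g] by simp

lemma free_phi_mult: "free_phi (f * g) = free_phi f \<star> free_phi g"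
proof (rule linear_eqI[where f = f and F = "\<lambda>f. free_phi (f * g)"])
  fix u
  show "free_phi (word u * g) = free_phi (word u) \<star> free_phi g"
  proof (rule linear_eqI[where f = g and F = "\<lambda>g. free_phi (word u * g)"])
    fix v
    have "foldr (\<lambda>a f. gen_image a \<star> f) u h = foldr (\<lambda>a f. gen_image a \<star> f) u 1 \<star> h" for h
      by (induction u) (simp_all add: shuffle_assoc)
    from this[of "foldr (\<lambda>a f. gen_image a \<star> f) v 1"]
    show "free_phi (word u * word v) = free_phi (word u) \<star> free_phi (word v)"
      by (simp add: word_mult free_phi_word)
  qed (simp_all add: free_alg_linear free_phi_add free_phi_scale shuffle_linear)
qed (simp_all add: free_alg_linear free_phi_add free_phi_scale shuffle_linear)

lemma qvar_plus_inverse_nonzero [simp]: "\<q> + inverse \<q> \<noteq> 0"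
  by (simp add: qvar_def Zero_fract_def eq_fract one_pCons)

lemma brace_3: "\<lbrace>3\<rbrace> = \<q> powi 2 - 1 + inverse (\<q> powi 2)"
proof -
  have "(\<q> powi 2 - 1 + inverse (\<q> powi 2)) * (\<q> + inverse \<q>) =
      \<q> powi (- 3) - (- 1) powi 3 * \<q> powi 3"
    by (simp add: power_int_minus field_simps power2_eq_square power3_eq_cube)
  then show ?thesis
    unfolding brace_def by (simp add: divide_eq_eq)
qed

lemma shuffle_serre_relation:
  assumes "a \<noteq> b"
  defines "x \<equiv> word [a]" and "y \<equiv> word [b]"
  shows "x \<star> (x \<star> (x \<star> y)) + scale \<lbrace>3\<rbrace> (x \<star> (x \<star> (y \<star> x)))
    - scale \<lbrace>3\<rbrace> (x \<star> (y \<star> (x \<star> x))) - y \<star> (x \<star> (x \<star> x)) = 0"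
proof -
  define s t m where "s = - (\<q> powi 2)" and "t = inverse s" and "m = \<lbrace>3\<rbrace>"
  have "s \<noteq> 0" by (simp add: s_def)
  have braid: "braiding [c] c = s" "braiding [a] b = t" "braiding [b] a = t" for c
    using assms(1) by (simp_all add: braiding_def letter_form_def s_def t_def power_int_minus)
  have m: "m = - s - 1 - t" by (simp add: brace_3 s_def t_def m_def)
  show ?thesis
    unfolding x_def y_def m_def[symmetric]
  proof (simp add: word_shuffle_word shuffle_linear free_alg_linear word_mult braid,
      rule poly_mapping_eqI, goal_cases)
    case (1 k)
    then show ?case
      using assms(1) \<open>s \<noteq> 0\<close>
      by (auto simp: lookup_add lookup_minus word_def lookup_single when_def m t_def field_simps)
  qed
qed

lemma free_phi_serre_relator:
  assumes "r \<in> {serre_relator GA GB, serre_relator GB GA}"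
  shows "free_phi r = 0"
  using assms shuffle_serre_relation[of LX LY] shuffle_serre_relation[of LY LX]
  by (auto simp: serre_relator_def free_phi_add free_phi_diff free_phi_scale free_phi_word)

lemma free_phi_serre_ideal: "f \<in> serre_ideal \<Longrightarrow> free_phi f = 0"
  by (induction rule: serre_ideal.induct)
    (simp_all only: free_phi_zero free_phi_add free_phi_mult free_phi_serre_relator,
      simp_all)

lift_definition phi :: "uq_plus \<Rightarrow> letter free_alg"  (\<open>\<phi>\<close>) is free_phi
  unfolding serre_cong_def by (drule free_phi_serre_ideal) (simp add: free_phi_diff)

lemma phi_A: "\<phi> uq_A = word [LX]" and phi_B: "\<phi> uq_B = word [LY]"
  by (transfer, simp add: free_phi_word)+

lemma phi_one: "\<phi> 1 = 1"
  by transfer (simp add: free_phi_word flip: word_Nil)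

lemma phi_add: "\<phi> (a + b) = \<phi> a + \<phi> b"
  by transfer (rule free_phi_add)

lemma phi_scale: "\<phi> (uq_scale c a) = scale c (\<phi> a)"
  by transfer (rule free_phi_scale)

lemma phi_mult: "\<phi> (a * b) = \<phi> a \<star> \<phi> b"
  by transfer (rule free_phi_mult)

lemma phi_parity_inv: "\<phi> (uq_parity_inv a) = parity_inv (\<phi> a)"
proof transfer
  fix f
  show "free_phi (parity_inv f) = parity_inv (free_phi f)"
  proof (rule linear_eqI[where f = f and F = "\<lambda>f. free_phi (parity_inv f)"])
    fix w :: "gen list"
    have "parity_inv (gen_image a) = scale (- 1) (gen_image a)" for a
      by (cases a) (simp_all add: parity_inv_word)
    then show "free_phi (parity_inv (word w)) = parity_inv (free_phi (word w))"
      unfolding parity_inv_word free_phi_scale free_phi_word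
      by (induction w)
        (simp_all add: parity_inv_shuffle shuffle_linear parity_inv_word flip: word_Nil,
          simp add: shuffle_minus_left flip: shuffle_scale_right)
  qed (simp_all add: parity_inv_add parity_inv_scale free_phi_add free_phi_scale)
qed

lemma phi_unique:
  assumes "\<And>a b. \<psi> (a + b) = \<psi> a + \<psi> b" "\<And>c a. \<psi> (uq_scale c a) = scale c (\<psi> a)"
    and "\<And>a b. \<psi> (a * b) = \<psi> a \<star> \<psi> b" "\<psi> 1 = 1"
    and "\<psi> uq_A = word [LX]" "\<psi> uq_B = word [LY]"
  shows "\<psi> = \<phi>"
proof
  fix a
  define \<pi> where "\<pi> = abs_uq_plus"
  have \<pi>: "\<pi> (f + g) = \<pi> f + \<pi> g" "\<pi> (scale c f) = uq_scale c (\<pi> f)"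
    "\<pi> (f * g) = \<pi> f * \<pi> g" "\<pi> 1 = 1" for f g c
    by (simp_all add: \<pi>_def plus_uq_plus.abs_eq uq_scale.abs_eq times_uq_plus.abs_eq
        one_uq_plus.abs_eq)
  have gens: "\<psi> (\<pi> (word [c])) = \<phi> (\<pi> (word [c]))" for c
    using assms(5,6) phi_A phi_B
    by (cases c) (simp_all add: \<pi>_def uq_A.abs_eq uq_B.abs_eq)
  have "\<psi> (\<pi> f) = \<phi> (\<pi> f)" for f
  proof (rule linear_eqI[where f = f and F = "\<lambda>f. \<psi> (\<pi> f)"])
    fix w
    show "\<psi> (\<pi> (word w)) = \<phi> (\<pi> (word w))"
    proof (induction w)
      case Nil
      then show ?case by (simp add: word_Nil \<pi> assms phi_one)
    next
      case (Cons c w)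
      have "word (c # w) = word [c] * word w" by (simp add: word_mult)
      then show ?case using Cons gens[of c] by (simp add: \<pi> assms phi_mult)
    qed
  qed (simp_all add: \<pi> assms phi_add phi_scale)
  moreover obtain f where "a = \<pi> f"
    unfolding \<pi>_def by (metis Quotient_uq_plus Quotient_abs_rep)
  ultimately show "\<psi> a = \<phi> a" by simp
qed


section \<open>The Catalan elements\<close>

fun letter_weight :: "letter \<Rightarrow> int"
  where
    "letter_weight LX = 1"
  | "letter_weight LY = - 1"

definition weight :: "letter list \<Rightarrow> int"
  where "weight w = (\<Sum>a\<leftarrow>w. letter_weight a)"

definition catalan :: "letter list \<Rightarrow> bool"
  where "catalan w \<longleftrightarrow> weight w = 0 \<and> (\<forall>i\<in>{1..length w}. weight (take i w) \<ge> 0)"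

definition Cat :: "nat \<Rightarrow> letter list set"
  where "Cat n = {w. catalan w \<and> length w = 2 * n}"

text \<open>\<open>catalan_coeff n w\<close> is meaningful for \<open>w \<in> Cat n\<close> only.\<close>

primrec catalan_coeff :: "nat \<Rightarrow> letter list \<Rightarrow> ground"
  where
    "catalan_coeff 0 w = 1"
  | "catalan_coeff (Suc n) w =
      (\<Sum>v\<in>Cat n. catalan_coeff n v *
        (\<Sum>i | i \<le> length v \<and> w = take i v @ [LX] @ drop i v @ [LY].
          (- 1) ^ i * \<lbrace>2 + 2 * weight (take i v)\<rbrace>))"

definition catalan_elem :: "nat \<Rightarrow> letter free_alg"
  where "catalan_elem n = (\<Sum>w\<in>Cat n. scale (catalan_coeff n w) (word w))"

lemma finite_Cat: "finite (Cat n)"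
proof -
  have "(UNIV :: letter set) = {LX, LY}" by (auto intro: letter.exhaust)
  then have "finite (UNIV :: letter set)" by (metis finite.simps)
  then have "finite {w :: letter list. set w \<subseteq> UNIV \<and> length w = 2 * n}"
    by (rule finite_lists_length_eq)
  then show ?thesis by (rule rev_finite_subset) (auto simp: Cat_def)
qed

lemma Cat_0: "Cat 0 = {[]}"
  by (auto simp: Cat_def catalan_def weight_def)

lemma catalan_elem_0: "catalan_elem 0 = 1"
  by (simp add: catalan_elem_def Cat_0 word_Nil)

lemma Cat_1: "Cat 1 = {[LX, LY]}"
proof -
  have "w = [LX, LY]" if "w \<in> Cat 1" for w
  proof -
    have "length w = Suc (Suc 0)" using that by (simp add: Cat_def)
    then obtain a b where "w = [a, b]" by (auto simp: length_Suc_conv)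
    then show ?thesis
      using that by (cases a; cases b)
        (auto simp: Cat_def catalan_def weight_def dest: bspec[where x = "Suc 0"])
  qed
  moreover have "weight (take i [LX, LY]) \<ge> 0" for i
    by (auto simp: weight_def take_Cons split: nat.split)
  then have "[LX, LY] \<in> Cat 1"
    by (simp add: Cat_def catalan_def weight_def)
  ultimately show ?thesis by blast
qed

lemma catalan_elem_1: "catalan_elem 1 = scale \<lbrace>2\<rbrace> (word [LX, LY])"
  unfolding catalan_elem_def Cat_1 by (simp add: Cat_0 weight_def)

end

theory Submission
  imports Defs
begin

text \<open>
  All braiding factors are powers of \<open>\<s> = - q^2\<close>: moving a letter past an equal letter costs
  \<open>\<s>\<close>, past the other letter \<open>\<s>^{-1}\<close>.  The signs of the superalgebra are thereby absorbed, and so are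
  those in the Catalan recursion, because
  \<open>(q + q^{-1}) (- 1)^h {2 + 2h} = \<s>^{1+h} - \<s>^{-(1+h)}\<close> and the height \<open>h\<close> of a
  Catalan word at position \<open>i\<close> has the parity of \<open>i\<close>.  Write \<open>D_n = (q + q^{-1})^n C_n\<close>.  In these
  terms the Catalan recursion says exactly that
  \<open>D_{n+1} = \<s> x \<star> (D_n y) - (D_n y) \<star> x\<close>, which is the defining
  equation of \<open>E_{(n+1)\<delta>}\<close> up to a scalar, since the insertion of \<open>x\<close> behind the last letter cancels.  As \<open>E_\<delta>\<close> is mapped to a multiple of \<open>xy\<close>, the two other
  formulas amount to \<open>[xD_n, xy] = xD_{n+1}\<close> and \<open>[xy, D_ny] = D_{n+1}y\<close> for the commutator of the
  shuffle product.

  Splitting off the last letters gives \<open>[xy, D_ny] = [xy, D_n]y + D_{n+1}y\<close>, so the second of them means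
  that \<open>D_n\<close> commutes with \<open>xy\<close>.  For the first, splitting off the first letters shows that one needs
  in addition the mirror image of the recursion,
  \<open>D_{n+1} = \<s> (xD_n) \<star> y - y \<star> (xD_n)\<close>.

  Both facts are proved by a joint induction (\<open>scaled_catalan_invariants\<close>).  The recursion and its mirror
  image are given by linear operators \<open>R\<close> and \<open>L\<close> that satisfy
  \<open>RLf - LRf = (\<s> - \<s>^{-1}) x (Lf - Rf + [f, xy]) y\<close> for \<open>f\<close> of weight zero
  (\<open>grow_right_grow_left_commutator\<close>); hence if \<open>LD_n = RD_n\<close> and \<open>D_n\<close> commutes with \<open>xy\<close>, then
  \<open>LD_{n+1} = LRD_n = RLD_n = RD_{n+1}\<close>.  For commutation with \<open>xy\<close>, let
  \<open>P_{ij} = \<s> (xD_i) \<star> (D_jy) - (D_jy) \<star> (xD_i)\<close>.  Since \<open>[xy, -]\<close> is a derivation, it sends \<open>P_{ij}\<close> to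
  \<open>P_{i,j+1} - P_{i+1,j}\<close>.  If all \<open>P_{ij}\<close> with \<open>i + j = n - 1\<close> are equal to \<open>D_n\<close>, the sum of these
  equations telescopes to \<open>n [xy, D_n] = P_{0n} - P_{n0} = RD_n - LD_n = 0\<close>, and then all \<open>P_{ij}\<close> with
  \<open>i + j = n\<close> coincide with \<open>P_{0n} = D_{n+1}\<close>.
\<close>

section \<open>The shuffle product by first and by last letters\<close>

abbreviation letter_x :: "letter free_alg"  (\<open>\<x>\<close>) where "\<x> \<equiv> word [LX]"
abbreviation letter_y :: "letter free_alg"  (\<open>\<y>\<close>) where "\<y> \<equiv> word [LY]"

definition braid_param :: ground  (\<open>\<s>\<close>)
  where "\<s> = - (\<q> powi 2)"

lemma braid_param_nonzero [simp]: "\<s> \<noteq> 0"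
  by (simp add: braid_param_def)

lemma braiding_Nil [simp]: "braiding [] b = 1"
  by (simp add: braiding_def)

lemma braiding_letter: "braiding [a] b = (if a = b then \<s> else inverse \<s>)"
  by (simp add: braiding_def letter_form_def braid_param_def power_int_minus)

lemma braiding_Cons: "braiding (a # u) b = braiding [a] b * braiding u b"
  using braiding_append[of "[a]" u b] by simp

lemma shuffle_diff_left: "(f - g) \<star> h = f \<star> h - g \<star> h"
  and shuffle_diff_right: "h \<star> (f - g) = h \<star> f - h \<star> g"
  using shuffle_add_left[of "f - g" g h] shuffle_add_right[of h "f - g" g] by simp_all

lemma twist_one [simp]: "twist b 1 = 1"
  using twist_word[of b "[]"] by (simp add: word_Nil)

lemma twist_diff: "twist b (f - g) = twist b f - twist b g"
  using twist_add[of b "f - g" g] by simp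

lemma twist_mult: "twist b (f * g) = twist b f * twist b g"
  by (rule linear_eqI[where f = f and F = "\<lambda>f. twist b (f * g)"])
    (simp_all add: free_alg_linear twist_add twist_scale twist_word_mult twist_word)

lemma twist_shuffle: "twist b (f \<star> g) = twist b f \<star> twist b g"
proof (rule linear_eqI[where f = f and F = "\<lambda>f. twist b (f \<star> g)"])
  fix u
  show "twist b (word u \<star> g) = twist b (word u) \<star> twist b g"
    by (rule linear_eqI[where f = g and F = "\<lambda>g. twist b (word u \<star> g)"])
      (simp_all add: shuffle_linear free_alg_linear twist_add twist_scale twist_word
        word_shuffle_word twist_shuffle_word mult.commute)
qed (simp_all add: shuffle_linear twist_add twist_scale)

text \<open>
  The defining recursion of the shuffle product splits off first letters.  Its mirror image
  holds because the product depends only on which pairs of letters change their order, and the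
  form is symmetric: in \<open>(ua) \<star> (vb)\<close> either \<open>b\<close> comes last and crosses nothing, or \<open>a\<close> comes last and
  is crossed by all of \<open>vb\<close>.
\<close>

lemma shuffle_word_snoc:
  "shuffle_word (u @ [a]) (v @ [b]) =
    shuffle_word (u @ [a]) v * word [b]
      + scale (braiding (v @ [b]) a) (shuffle_word u (v @ [b]) * word [a])"
proof (induction "length u + length v" arbitrary: u v rule: less_induct)
  case less
  have letter_swap: "braiding [c] d = braiding [d] c" for c d
    by (simp add: braiding_letter)
  show ?case
  proof (cases u; cases v)
    assume "u = []" "v = []"
    then show ?thesis by (simp add: word_mult letter_swap[of a b])
  next
    fix d v' assume eq: "u = []" "v = d # v'"
    have IH: "shuffle_word ([] @ [a]) (v' @ [b]) =
        shuffle_word ([] @ [a]) v' * word [b]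
          + scale (braiding (v' @ [b]) a) (shuffle_word [] (v' @ [b]) * word [a])"
      by (rule less) (simp add: eq)
    show ?thesis
      using IH unfolding eq
      by (simp add: word_mult free_alg_linear braiding_Cons[of d "_ @ _"] letter_swap[of a d]
          ac_simps)
  next
    fix c u' assume eq: "u = c # u'" "v = []"
    have IH: "shuffle_word (u' @ [a]) ([] @ [b]) =
        shuffle_word (u' @ [a]) [] * word [b]
          + scale (braiding ([] @ [b]) a) (shuffle_word u' ([] @ [b]) * word [a])"
      by (rule less) (simp add: eq)
    show ?thesis
      using IH unfolding eq
      by (simp add: word_mult free_alg_linear braiding_append letter_swap[of a b]
          braiding_Cons[of c "_ @ _"] braiding_Cons[of c u'] ac_simps)
  next
    fix c u' d v' assume eq: "u = c # u'" "v = d # v'"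
    have IH1: "shuffle_word (u' @ [a]) (v @ [b]) =
        shuffle_word (u' @ [a]) v * word [b]
          + scale (braiding (v @ [b]) a) (shuffle_word u' (v @ [b]) * word [a])"
      and IH2: "shuffle_word (u @ [a]) (v' @ [b]) =
        shuffle_word (u @ [a]) v' * word [b]
          + scale (braiding (v' @ [b]) a) (shuffle_word u (v' @ [b]) * word [a])"
      by (rule less, simp add: eq)+
    show ?thesis
      using IH1 IH2 unfolding eq
      by (simp add: free_alg_linear braiding_append braiding_Cons[of c "_ @ _"]
          braiding_Cons[of c u'] braiding_Cons[of d "_ @ _"] braiding_Cons[of d v']
          letter_swap[of a d] ac_simps)
  qed
qed

lemma shuffle_snoc:
  "(f * word [a]) \<star> (g * word [b]) =
    ((f * word [a]) \<star> g) * word [b] + (f \<star> twist a (g * word [b])) * word [a]"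
proof (rule linear_eqI[where f = f and F = "\<lambda>f. (f * word [a]) \<star> (g * word [b])"])
  fix u
  show "(word u * word [a]) \<star> (g * word [b]) =
    ((word u * word [a]) \<star> g) * word [b] + (word u \<star> twist a (g * word [b])) * word [a]"
  proof (rule linear_eqI[where f = g and F = "\<lambda>g. (word u * word [a]) \<star> (g * word [b])"])
    fix v
    show "(word u * word [a]) \<star> (word v * word [b]) =
      ((word u * word [a]) \<star> word v) * word [b]
        + (word u \<star> twist a (word v * word [b])) * word [a]"
      by (simp add: word_mult word_shuffle_word twist_word shuffle_linear free_alg_linear
          shuffle_word_snoc)
  qed (simp_all add: free_alg_linear shuffle_linear twist_add twist_scale)
qed (simp_all add: free_alg_linear shuffle_linear twist_add twist_scale)

lemma twist_letter: "twist b (word [a]) = scale (if a = b then \<s> else inverse \<s>) (word [a])"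
  by (simp add: twist_word braiding_letter)

section \<open>Growing balanced elements\<close>

text \<open>
  The span of the words with as many \<open>x\<close> as \<open>y\<close>, characterised by the fact that letters cross its
  elements without a factor.
\<close>

definition balanced :: "letter free_alg \<Rightarrow> bool"
  where "balanced f \<longleftrightarrow> twist LX f = f \<and> twist LY f = f"

definition shuffle_comm :: "letter free_alg \<Rightarrow> letter free_alg \<Rightarrow> letter free_alg"
  where "shuffle_comm f g = f \<star> g - g \<star> f"

text \<open>
  On balanced elements \<open>grow_right\<close> appends \<open>y\<close> and inserts \<open>x\<close> before it, as in the recursion for the
  Catalan elements; \<open>grow_left\<close>, its conjugate under reversing words and exchanging the letters,
  prepends \<open>x\<close> and inserts \<open>y\<close> after it.
\<close>

definition grow_right :: "letter free_alg \<Rightarrow> letter free_alg"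
  where "grow_right f = scale \<s> (\<x> \<star> (f * \<y>)) - (f * \<y>) \<star> \<x>"

definition grow_left :: "letter free_alg \<Rightarrow> letter free_alg"
  where "grow_left f = scale \<s> ((\<x> * f) \<star> \<y>) - \<y> \<star> (\<x> * f)"

lemma shuffle_Cons_letter:
  "(word [a] * f) \<star> word [b] = word [a] * (f \<star> word [b]) + word [b] * twist b (word [a] * f)"
  "word [a] \<star> (word [b] * g) =
    word [a] * (word [b] * g) + word [b] * (twist b (word [a]) \<star> g)"
  using shuffle_Cons[of a f b 1] shuffle_Cons[of a 1 b g] by simp_all

lemma shuffle_snoc_letter:
  "(f * word [a]) \<star> word [b] = f * word [a] * word [b] + (f \<star> twist a (word [b])) * word [a]"
  "word [a] \<star> (g * word [b]) = (word [a] \<star> g) * word [b] + twist a (g * word [b]) * word [a]"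
  using shuffle_snoc[of f a 1 b] shuffle_snoc[of 1 a g b] by simp_all

text \<open>
  In \<open>\<s> x \<star> (fy) - (fy) \<star> x\<close> the two terms \<open>fyx\<close> cancel, so that every remaining word ends in \<open>y\<close>.
\<close>

lemma grow_right_factored:
  assumes "balanced f"
  shows "grow_right f = (scale \<s> (\<x> \<star> f) - scale (inverse \<s>) (f \<star> \<x>)) * \<y>"
  using assms unfolding balanced_def grow_right_def
  by (simp add: shuffle_snoc_letter twist_mult twist_letter shuffle_linear free_alg_linear
      left_diff_distrib)

lemma grow_left_factored:
  assumes "balanced f"
  shows "grow_left f = \<x> * (scale \<s> (f \<star> \<y>) - scale (inverse \<s>) (\<y> \<star> f))"
  using assms unfolding balanced_def grow_left_def
  by (simp add: shuffle_Cons_letter twist_mult twist_letter shuffle_linear free_alg_linear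
      right_diff_distrib)

lemma balanced_grow:
  assumes "balanced f"
  shows "balanced (grow_right f)" "balanced (grow_left f)"
  using assms unfolding balanced_def grow_right_def grow_left_def
  by (simp_all add: twist_diff twist_scale twist_shuffle twist_mult twist_letter shuffle_linear
      free_alg_linear)

text \<open>
  In a shuffle of \<open>xy\<close> with \<open>fy\<close> either the \<open>y\<close> of \<open>fy\<close> comes last, which contributes to \<open>[xy, f]y\<close>, or
  the \<open>y\<close> of \<open>xy\<close> does, and then only \<open>x\<close> is left to be shuffled into \<open>fy\<close>; the crossings of the
  last \<open>y\<close> provide the factor \<open>\<s>\<close> in the definition of \<open>grow_right\<close>.
\<close>

lemma shuffle_comm_xy_snoc:
  assumes "balanced f"
  shows "shuffle_comm (\<x> * \<y>) (f * \<y>) = (shuffle_comm (\<x> * \<y>) f + grow_right f) * \<y>"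
  using assms unfolding balanced_def grow_right_def shuffle_comm_def shuffle_snoc
  by (simp add: twist_mult twist_letter shuffle_linear free_alg_linear
      left_diff_distrib)

lemma shuffle_comm_xy_Cons:
  assumes "balanced f"
  shows "shuffle_comm (\<x> * f) (\<x> * \<y>) = \<x> * (shuffle_comm f (\<x> * \<y>) + grow_left f)"
  using assms unfolding balanced_def grow_left_def shuffle_comm_def shuffle_Cons
  by (simp add: twist_mult twist_letter shuffle_linear free_alg_linear
      right_diff_distrib)

text \<open>
  Write \<open>Lf = xh\<close> and \<open>Rf = ky\<close>.  The two compositions insert the same letters into \<open>f\<close>, and by
  associativity of the shuffle product they differ only in the terms \<open>xxhy\<close> and \<open>xkyy\<close>, where the
  letter inserted last lies outside the one attached before, and in
  \<open>[f, \<s> x \<star> y - y \<star> x]\<close>, whose second argument is \<open>(\<s> - \<s>^{-1}) xy\<close>.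
\<close>

lemma grow_right_grow_left_commutator:
  assumes "balanced f"
  shows "grow_right (grow_left f) - grow_left (grow_right f) =
    scale (\<s> - inverse \<s>) (\<x> * (grow_left f - grow_right f + shuffle_comm f (\<x> * \<y>)) * \<y>)"
proof -
  define h k where "h = scale \<s> (f \<star> \<y>) - scale (inverse \<s>) (\<y> \<star> f)"
    and "k = scale \<s> (\<x> \<star> f) - scale (inverse \<s>) (f \<star> \<x>)"
  have fac: "grow_left f = \<x> * h" "grow_right f = k * \<y>"
    using grow_left_factored[OF assms] grow_right_factored[OF assms] by (simp_all add: h_def k_def)
  have tw: "twist LX h = scale (inverse \<s>) h" "twist LY k = scale (inverse \<s>) k"
    using assms unfolding balanced_def h_def k_def
    by (simp_all add: twist_diff twist_scale twist_shuffle twist_letter shuffle_linear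
        free_alg.scale_right_diff_distrib mult.commute)
  have xy: "scale (\<s> - inverse \<s>) (\<x> * \<y>) = scale \<s> (\<x> \<star> \<y>) - \<y> \<star> \<x>"
    by (simp add: word_shuffle_word word_mult braiding_letter free_alg_linear
        free_alg.scale_left_diff_distrib)
  have "grow_right (grow_left f) =
      (scale (\<s> - inverse \<s>) (\<x> * \<x> * h)
        + \<x> * (scale (\<s> * \<s>) (\<x> \<star> h) - scale (inverse \<s>) (h \<star> \<x>))) * \<y>"
    unfolding grow_right_factored[OF balanced_grow(2)[OF assms]] unfolding fac
    by (simp add: shuffle_Cons_letter twist_mult twist_letter tw shuffle_linear free_alg_linear
        free_alg.scale_left_diff_distrib algebra_simps)
  moreover have "grow_left (grow_right f) =
      \<x> * (scale (\<s> - inverse \<s>) (k * \<y> * \<y>)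
        + (scale (\<s> * \<s>) (k \<star> \<y>) - scale (inverse \<s>) (\<y> \<star> k)) * \<y>)"
    unfolding grow_left_factored[OF balanced_grow(1)[OF assms]] unfolding fac
    by (simp add: shuffle_snoc_letter twist_mult twist_letter tw shuffle_linear free_alg_linear
        free_alg.scale_left_diff_distrib algebra_simps)
  moreover have "scale (\<s> * \<s>) (\<x> \<star> h) - scale (inverse \<s>) (h \<star> \<x>)
      - (scale (\<s> * \<s>) (k \<star> \<y>) - scale (inverse \<s>) (\<y> \<star> k))
      = scale (\<s> - inverse \<s>) (shuffle_comm f (\<x> * \<y>))"
  proof -
    have "scale (\<s> - inverse \<s>) (shuffle_comm f (\<x> * \<y>)) =
        f \<star> scale (\<s> - inverse \<s>) (\<x> * \<y>) - scale (\<s> - inverse \<s>) (\<x> * \<y>) \<star> f"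
      by (simp only: shuffle_comm_def shuffle_linear free_alg.scale_right_diff_distrib)
    moreover have cancel: "\<s> * \<s> * inverse \<s> = \<s>" by simp
    ultimately show ?thesis
      unfolding xy h_def k_def
      by (simp add: cancel shuffle_linear shuffle_diff_left shuffle_diff_right shuffle_assoc
          free_alg.scale_right_diff_distrib)
  qed
  then have "scale (\<s> * \<s>) (\<x> \<star> h) - scale (inverse \<s>) (h \<star> \<x>)
      = scale (\<s> * \<s>) (k \<star> \<y>) - scale (inverse \<s>) (\<y> \<star> k)
        + scale (\<s> - inverse \<s>) (shuffle_comm f (\<x> * \<y>))"
    by (simp only: diff_eq_eq add.commute)
  ultimately show ?thesis
    unfolding fac
    by (simp only: free_alg_linear left_diff_distrib right_diff_distrib
        free_alg.scale_right_diff_distrib mult.assoc) (simp add: algebra_simps)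
qed

section \<open>The scaled Catalan elements commute with $xy$\<close>

text \<open>
  These are the elements \<open>D_n = (q + q^{-1})^n C_n\<close>; see \<open>scaled_catalan_conv_catalan_elem\<close> below.
\<close>

primrec scaled_catalan :: "nat \<Rightarrow> letter free_alg"
  where
    "scaled_catalan 0 = 1"
  | "scaled_catalan (Suc n) = grow_right (scaled_catalan n)"

lemma balanced_scaled_catalan: "balanced (scaled_catalan n)"
  by (induction n) (simp_all add: balanced_grow balanced_def[of 1])

text \<open>
  Up to a scalar, the image of \<open>q^{-2} E_{j\<delta>+\<alpha>1} E_{i\<delta>+\<alpha>0} + E_{i\<delta>+\<alpha>0} E_{j\<delta>+\<alpha>1}\<close>, which turns out to depend on
  \<open>i + j\<close> only.
\<close>

definition cross :: "nat \<Rightarrow> nat \<Rightarrow> letter free_alg"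
  where "cross i j =
    scale \<s> ((\<x> * scaled_catalan i) \<star> (scaled_catalan j * \<y>))
      - (scaled_catalan j * \<y>) \<star> (\<x> * scaled_catalan i)"

lemma cross_0_left: "cross 0 n = grow_right (scaled_catalan n)"
  and cross_0_right: "cross n 0 = grow_left (scaled_catalan n)"
  by (simp_all add: cross_def grow_right_def grow_left_def)

lemma shuffle_comm_swap: "shuffle_comm f g = - shuffle_comm g f"
  by (simp add: shuffle_comm_def)

text \<open>
  The commutator with \<open>xy\<close> is a derivation of the shuffle product.  Under the hypotheses it sends
  \<open>xD_i\<close> to \<open>- xD_{i+1}\<close> and \<open>D_jy\<close> to \<open>D_{j+1}y\<close>.
\<close>

lemma shuffle_comm_cross:
  assumes "shuffle_comm (\<x> * \<y>) (scaled_catalan i) = 0" "shuffle_comm (\<x> * \<y>) (scaled_catalan j) = 0"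
    and "grow_left (scaled_catalan i) = scaled_catalan (Suc i)"
  shows "shuffle_comm (\<x> * \<y>) (cross i j) = cross i (Suc j) - cross (Suc i) j"
proof -
  let ?D = "\<x> * \<y>" and ?a = "\<x> * scaled_catalan i" and ?b = "scaled_catalan j * \<y>"
  have "shuffle_comm (scaled_catalan i) ?D = 0"
    using assms(1) shuffle_comm_swap[of "scaled_catalan i"] by simp
  then have a: "?D \<star> ?a = ?a \<star> ?D - \<x> * scaled_catalan (Suc i)"
    using shuffle_comm_xy_Cons[OF balanced_scaled_catalan, of i] assms(3)
    by (simp add: shuffle_comm_def algebra_simps)
  have b: "?D \<star> ?b = ?b \<star> ?D + scaled_catalan (Suc j) * \<y>"
    using shuffle_comm_xy_snoc[OF balanced_scaled_catalan, of j] assms(2)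
    by (simp add: shuffle_comm_def algebra_simps)
  have "?D \<star> (?a \<star> ?b) = ?a \<star> (?b \<star> ?D) + ?a \<star> (scaled_catalan (Suc j) * \<y>)
      - (\<x> * scaled_catalan (Suc i)) \<star> ?b"
    by (simp only: shuffle_assoc[symmetric] a shuffle_diff_left)
      (simp only: shuffle_assoc b shuffle_add_right)
  moreover have "?D \<star> (?b \<star> ?a) = ?b \<star> (?a \<star> ?D) - ?b \<star> (\<x> * scaled_catalan (Suc i))
      + (scaled_catalan (Suc j) * \<y>) \<star> ?a"
    by (simp only: shuffle_assoc[symmetric] b shuffle_add_left)
      (simp only: shuffle_assoc a shuffle_diff_right)
  ultimately show ?thesis
    unfolding cross_def shuffle_comm_def shuffle_diff_right shuffle_diff_left shuffle_linear
      shuffle_assoc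
    by (simp add: free_alg.scale_right_distrib free_alg.scale_right_diff_distrib)
qed

text \<open>
  The three statements support each other: the symmetry of \<open>D_n\<close> follows from symmetry and
  commutation at \<open>n - 1\<close>; commutation at \<open>n\<close> follows from symmetry at \<open>n\<close>, the earlier commutations and
  the third statement at \<open>n - 1\<close>; and it yields the third statement at \<open>n\<close>.
\<close>

lemma scaled_catalan_invariants:
  "grow_left (scaled_catalan n) = scaled_catalan (Suc n) \<and>
    (\<forall>k\<le>n. shuffle_comm (\<x> * \<y>) (scaled_catalan k) = 0) \<and>
    (\<forall>i j. i + j = n \<longrightarrow> cross i j = scaled_catalan (Suc n))"
proof (induction n rule: less_induct)
  case (less n)
  show ?case
  proof (cases n)
    case 0
    have "grow_left 1 = grow_right 1"
      by (simp add: grow_left_def grow_right_def)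
    then show ?thesis
      using cross_0_left[of 0] by (simp add: 0 shuffle_comm_def)
  next
    case (Suc m)
    have IH: "grow_left (scaled_catalan k) = scaled_catalan (Suc k)" "shuffle_comm (\<x> * \<y>) (scaled_catalan k) = 0"
      "\<And>i j. i + j = k \<Longrightarrow> cross i j = scaled_catalan (Suc k)" if "k \<le> m" for k
      using less.IH[of k] that by (auto simp: Suc)
    have sym: "grow_left (scaled_catalan n) = scaled_catalan (Suc n)"
    proof -
      have "shuffle_comm (scaled_catalan m) (\<x> * \<y>) = 0"
        using IH(2)[of m] shuffle_comm_swap[of "scaled_catalan m"] by simp
      then show ?thesis
        using grow_right_grow_left_commutator[OF balanced_scaled_catalan, of m] IH(1)[of m] by (simp add: Suc)
    qed
    define d where "d = shuffle_comm (\<x> * \<y>) (scaled_catalan n)"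
    have step: "cross (Suc i) j = cross i (Suc j) - d" if "i + j = m" for i j
      using shuffle_comm_cross[of i j] IH(1,2)[of i] IH(2)[of j] IH(3)[OF order.refl that] that
      by (simp add: d_def Suc algebra_simps)
    (* Comparing i = n with the symmetry of D_n forces n d = 0: characteristic zero enters here. *)
    have lin: "cross i (n - i) = scaled_catalan (Suc n) - scale (of_nat i) d" if "i \<le> n" for i
      using that
    proof (induction i)
      case 0
      then show ?case by (simp add: cross_0_left)
    next
      case (Suc i)
      then have "cross (Suc i) (n - Suc i) = cross i (Suc (n - Suc i)) - d"
        using \<open>n = Suc m\<close> by (intro step) simp
      moreover have "Suc (n - Suc i) = n - i" using Suc by simp
      ultimately show ?case using Suc by (simp add: free_alg.scale_left_distrib algebra_simps)
    qed
    have "scale (of_nat n) d = 0"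
      using lin[of n] cross_0_right[of n] sym by simp
    then have "d = 0" by (simp add: Suc del: of_nat_Suc)
    then have "cross i j = scaled_catalan (Suc n)" if "i + j = n" for i j
      using lin[of i] that by auto
    moreover have "shuffle_comm (\<x> * \<y>) (scaled_catalan k) = 0" if "k \<le> n" for k
      using IH(2)[of k] \<open>d = 0\<close> that by (cases "k = n") (auto simp: d_def Suc)
    ultimately show ?thesis using sym by blast
  qed
qed

section \<open>The recursion of the Catalan elements\<close>

lemma weight_Nil [simp]: "weight [] = 0"
  and weight_Cons [simp]: "weight (a # w) = letter_weight a + weight w"
  and weight_append [simp]: "weight (u @ v) = weight u + weight v"
  by (simp_all add: weight_def)

lemma braiding_weight:
  "braiding w LX = \<s> powi weight w" "braiding w LY = \<s> powi (- weight w)"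
proof (induction w)
  case (Cons a w)
  have add: "\<s> powi (k + l) = \<s> powi k * \<s> powi l" for k l
    by (simp add: power_int_add)
  have a: "braiding [a] LX = \<s> powi letter_weight a"
    "braiding [a] LY = \<s> powi (- letter_weight a)"
    by (cases a; simp add: braiding_letter power_int_minus)+
  case 1
  show ?case by (simp only: braiding_Cons[of a w] a Cons weight_Cons add)
  case 2
  show ?case by (simp only: braiding_Cons[of a w] a Cons weight_Cons minus_add_distrib add)
qed simp_all

lemma x_shuffle_word:
  "\<x> \<star> word w =
    (\<Sum>i\<le>length w. scale (\<s> powi weight (take i w)) (word (take i w @ [LX] @ drop i w)))"
proof (induction w)
  case (Cons a w)
  have "\<x> \<star> word (a # w) = word (LX # a # w) + scale (braiding [a] LX) (word [a] * (\<x> \<star> word w))"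
    using shuffle_Cons_letter(2)[of LX a "word w"]
    by (simp add: word_mult twist_letter braiding_letter shuffle_linear free_alg_linear)
  then show ?case
    unfolding Cons sum.atMost_Suc_shift length_Cons
    by (simp add: sum_distrib_left scale_mult_right free_alg.scale_sum_right word_mult
        braiding_weight power_int_add)
qed (simp add: word_shuffle_word)

lemma word_shuffle_x:
  "word w \<star> \<x> =
    (\<Sum>i\<le>length w. scale (\<s> powi weight (drop i w)) (word (take i w @ [LX] @ drop i w)))"
proof (induction w)
  case (Cons a w)
  have "word (a # w) \<star> \<x> = scale (braiding (a # w) LX) (word (LX # a # w)) + word [a] * (word w \<star> \<x>)"
    using shuffle_Cons_letter(1)[of a "word w" LX]
    by (simp add: word_mult twist_word shuffle_linear free_alg_linear add.commute)
  then show ?case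
    unfolding Cons sum.atMost_Suc_shift length_Cons
    by (simp add: sum_distrib_left scale_mult_right word_mult braiding_weight)
qed (simp add: word_shuffle_word)

lemma balanced_word: "weight w = 0 \<Longrightarrow> balanced (word w)"
  by (simp add: balanced_def twist_word braiding_weight)

text \<open>
  When \<open>x\<close> enters \<open>vy\<close> at height \<open>h\<close> from the left, it crosses letters of total weight \<open>h\<close>; from the
  right, letters of total weight \<open>- 1 - h\<close>.  With the factor \<open>\<s>\<close> on the product from the left, the
  difference is the coefficient in the Catalan recursion.
\<close>

lemma grow_right_word:
  assumes "weight v = 0"
  shows "grow_right (word v) =
    (\<Sum>i\<le>length v. scale (\<s> powi (1 + weight (take i v)) - \<s> powi (- (1 + weight (take i v))))
      (word (take i v @ [LX] @ drop i v @ [LY])))"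
proof -
  have drop: "weight (drop i v) = - weight (take i v)" for i
    using weight_append[of "take i v" "drop i v"] assms by simp
  show ?thesis
    unfolding grow_right_factored[OF balanced_word[OF assms]] x_shuffle_word word_shuffle_x drop
    by (simp add: free_alg.scale_sum_right sum_distrib_right word_mult scale_mult_left
        power_int_add power_int_diff power_int_minus free_alg.scale_left_diff_distrib sum_subtractf
        left_diff_distrib divide_inverse)
qed

lemma grow_right_add: "grow_right (f + g) = grow_right f + grow_right g"
  and grow_right_scale: "grow_right (scale c f) = scale c (grow_right f)"
  by (simp_all add: grow_right_def shuffle_linear free_alg_linear free_alg.scale_right_diff_distrib
      mult.commute)

lemma grow_right_sum: "grow_right (sum F S) = (\<Sum>v\<in>S. grow_right (F v))"
proof -
  have "grow_right 0 = 0" by (simp add: grow_right_def)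
  then show ?thesis
    by (induction S rule: infinite_finite_induct) (simp_all add: grow_right_add)
qed

lemma Cat_insert:
  assumes "v \<in> Cat n" "i \<le> length v"
  shows "take i v @ [LX] @ drop i v @ [LY] \<in> Cat (Suc n)"
proof -
  let ?w = "take i v @ [LX] @ drop i v @ [LY]"
  have v: "weight v = 0" "length v = 2 * n" using assms by (auto simp: Cat_def catalan_def)
  have pos: "weight (take j v) \<ge> 0" for j
  proof (cases "j \<in> {1..length v}")
    case False
    then have "j = 0 \<or> take j v = v" by auto
    then show ?thesis using v by auto
  qed (use assms in \<open>auto simp: Cat_def catalan_def\<close>)
  have sum: "weight (take i v) + weight (drop i v) = 0"
    using weight_append[of "take i v" "drop i v"] v by simp
  have "weight (take j ?w) \<ge> 0" for j
  proof (cases "j \<le> i")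
    case True
    then show ?thesis using pos[of j] assms(2) by (simp add: min_absorb1)
  next
    case False
    then obtain k where k: "j = Suc (i + k)" using less_imp_Suc_add[of i j] by auto
    have "weight (take i v) + weight (take k (drop i v)) \<ge> 0"
      using pos[of "i + k"] by (simp add: take_add)
    moreover have "weight (take m [LY]) \<ge> - 1" for m
      by (cases m) simp_all
    ultimately show ?thesis
      using assms(2) by (simp add: k min_absorb2 add_increasing2) (smt (verit))
  qed
  then show ?thesis
    using assms(2) v sum by (simp add: Cat_def catalan_def)
qed

lemma even_weight: "even (weight w) \<longleftrightarrow> even (length w)"
proof (induction w)
  case (Cons a w)
  then show ?case by (cases a) simp_all
qed simp

lemma brace_weight:
  assumes "even i \<longleftrightarrow> even h"
  shows "(\<q> + inverse \<q>) * ((- 1) ^ i * \<lbrace>2 + 2 * h\<rbrace>) = \<s> powi (1 + h) - \<s> powi (- (1 + h))"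
proof -
  have pow: "\<s> powi k = (if even k then \<q> powi (2 * k) else - (\<q> powi (2 * k)))" for k
    by (simp add: braid_param_def power_int_minus_left power_int_mult)
  have "(\<q> + inverse \<q>) * \<lbrace>2 + 2 * h\<rbrace> = \<q> powi (- (2 * (1 + h))) - \<q> powi (2 * (1 + h))"
    by (simp add: brace_def power_int_minus_left)
  then have "(\<q> + inverse \<q>) * ((- 1) ^ i * \<lbrace>2 + 2 * h\<rbrace>) =
      (- 1) ^ i * (\<q> powi (2 * - (1 + h)) - \<q> powi (2 * (1 + h)))"
    by (simp only: mult.left_commute[of "\<q> + inverse \<q>"] mult_minus_right)
  then show ?thesis
    using assms unfolding pow by (cases "even i") (simp_all del: minus_add_distrib)
qed

text \<open>
  The recursion for the coefficients sums, for each word \<open>w\<close>, over the insertions that produce \<open>w\<close>.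
  Summing over the insertions first gives \<open>grow_right\<close>.
\<close>

lemma grow_right_catalan_elem:
  "grow_right (catalan_elem n) = scale (\<q> + inverse \<q>) (catalan_elem (Suc n))"
proof -
  define ins where "ins v i = take i v @ [LX] @ drop i v @ [LY]" for v i
  define e :: "letter list \<Rightarrow> nat \<Rightarrow> ground"
    where "e v i = (- 1) ^ i * \<lbrace>2 + 2 * weight (take i v)\<rbrace>" for v i
  have regroup: "(\<Sum>w\<in>Cat (Suc n). scale (\<Sum>i | i \<le> length v \<and> w = ins v i. e v i) (word w)) =
      (\<Sum>i\<le>length v. scale (e v i) (word (ins v i)))" if "v \<in> Cat n" for v
  proof -
    have "(\<Sum>w\<in>Cat (Suc n). scale (\<Sum>i | i \<le> length v \<and> w = ins v i. e v i) (word w)) =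
        (\<Sum>w\<in>Cat (Suc n). \<Sum>i | i \<in> {..length v} \<and> ins v i = w. scale (e v i) (word (ins v i)))"
      by (intro sum.cong refl) (auto simp: free_alg.scale_sum_left intro!: sum.cong)
    also have "\<dots> = (\<Sum>i\<le>length v. scale (e v i) (word (ins v i)))"
      by (intro sum.group finite_Cat) (auto simp: ins_def simp del: append.simps intro!: Cat_insert that)
    finally show ?thesis .
  qed
  have word: "grow_right (word v) =
      scale (\<q> + inverse \<q>) (\<Sum>i\<le>length v. scale (e v i) (word (ins v i)))" if "v \<in> Cat n" for v
  proof -
    have "weight v = 0" using that by (simp add: Cat_def catalan_def)
    moreover have "(\<q> + inverse \<q>) * e v i =
        \<s> powi (1 + weight (take i v)) - \<s> powi (- (1 + weight (take i v)))" if "i \<le> length v" for i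
      unfolding e_def by (rule brace_weight) (simp add: even_weight that)
    ultimately show ?thesis
      by (simp add: grow_right_word free_alg.scale_sum_right ins_def cong: sum.cong_simp)
  qed
  have elem: "catalan_elem (Suc n) = (\<Sum>w\<in>Cat (Suc n). \<Sum>v\<in>Cat n. scale (catalan_coeff n v)
      (scale (\<Sum>i | i \<le> length v \<and> w = ins v i. e v i) (word w)))"
    unfolding catalan_elem_def catalan_coeff.simps(2) e_def ins_def free_alg.scale_scale
    by (intro sum.cong refl free_alg.scale_sum_left)
  have "grow_right (catalan_elem n) = scale (\<q> + inverse \<q>)
      (\<Sum>v\<in>Cat n. scale (catalan_coeff n v)
        (\<Sum>w\<in>Cat (Suc n). scale (\<Sum>i | i \<le> length v \<and> w = ins v i. e v i) (word w)))"
    by (simp add: catalan_elem_def grow_right_sum grow_right_scale word regroup free_alg.scale_sum_right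
        mult_ac)
  also have "\<dots> = scale (\<q> + inverse \<q>) (catalan_elem (Suc n))"
    unfolding elem free_alg.scale_sum_right[of "catalan_coeff n _"] by (subst sum.swap) (rule refl)
  finally show ?thesis .
qed

lemma scaled_catalan_conv_catalan_elem: "scaled_catalan n = scale ((\<q> + inverse \<q>) ^ n) (catalan_elem n)"
proof (induction n)
  case 0
  show ?case by (simp add: catalan_elem_0)
next
  case (Suc n)
  show ?case
    by (simp only: scaled_catalan.simps Suc grow_right_scale grow_right_catalan_elem free_alg.scale_scale
        power_Suc2)
qed

section \<open>The images of the PBW generators\<close>

lemma phi_diff: "\<phi> (a - b) = \<phi> a - \<phi> b"
  using phi_add[of "a - b" b] by simp

lemma qvar_diff_inverse_nonzero: "\<q> - inverse \<q> \<noteq> 0"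
proof
  assume "\<q> - inverse \<q> = 0"
  then have "\<q> * \<q> = 1"
    by (metis eq_iff_diff_eq_0 qvar_nonzero right_inverse)
  then show False
    by (simp add: qvar_def One_fract_def eq_fract one_pCons)
qed

lemma phi_super_comm_E_delta1:
  defines "c \<equiv> \<q> powi (- 2) * (\<q> + inverse \<q>) * (\<q> - inverse \<q>)"
  shows "\<phi> (super_comm a E_delta1) = scale c (shuffle_comm (\<phi> a) (\<x> * \<y>))"
    and "\<phi> (super_comm E_delta1 a) = scale c (shuffle_comm (\<x> * \<y>) (\<phi> a))"
proof -
  have "\<phi> E_delta1 = scale (\<q> powi (- 2)) (\<y> \<star> \<x>) + \<x> \<star> \<y>"
    by (simp add: E_delta1_def phi_add phi_scale phi_mult phi_A phi_B)
  also have "\<dots> = scale c (\<x> * \<y>)"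
  proof -
    have s: "inverse \<s> = - (\<q> powi (- 2))"
      by (simp add: braid_param_def power_int_minus)
    have c: "c = 1 - \<q> powi (- 2) * \<q> powi (- 2)"
      by (simp add: c_def power_int_minus field_simps power2_eq_square)
    show ?thesis
      by (simp add: word_shuffle_word word_mult braiding_letter s c free_alg.scale_right_distrib
          free_alg.scale_left_diff_distrib free_alg.scale_right_diff_distrib)
  qed
  finally have "\<phi> E_delta1 = scale c (\<x> * \<y>)" .
  then show "\<phi> (super_comm a E_delta1) = scale c (shuffle_comm (\<phi> a) (\<x> * \<y>))"
    and "\<phi> (super_comm E_delta1 a) = scale c (shuffle_comm (\<x> * \<y>) (\<phi> a))"
    by (simp_all add: super_comm_even_left super_comm_even_right uq_even_E_delta1 phi_diff
        phi_mult shuffle_comm_def shuffle_linear free_alg.scale_right_diff_distrib)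
qed

lemma phi_E_alpha_scaled_catalan:
  defines "c \<equiv> \<q> powi (- 2) * (\<q> + inverse \<q>)"
  shows "\<phi> (E_alpha0 n) = scale (c ^ n) (\<x> * scaled_catalan n)"
    and "\<phi> (E_alpha1 n) = scale (c ^ n) (scaled_catalan n * \<y>)"
proof (induction n)
  case 0
  case 1 show ?case by (simp add: phi_A)
  case 2 show ?case by (simp add: phi_B)
next
  case (Suc n)
  have central: "shuffle_comm (\<x> * \<y>) (scaled_catalan n) = 0" "shuffle_comm (scaled_catalan n) (\<x> * \<y>) = 0"
    using scaled_catalan_invariants[of n] shuffle_comm_swap[of "scaled_catalan n"] by auto
  have scale: "inverse (\<q> - inverse \<q>) * (\<q> powi (- 2) * (\<q> + inverse \<q>) * (\<q> - inverse \<q>)) = c"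
    using qvar_diff_inverse_nonzero by (simp add: c_def)
  have "shuffle_comm (\<x> * scaled_catalan n) (\<x> * \<y>) = \<x> * scaled_catalan (Suc n)"
    and "shuffle_comm (\<x> * \<y>) (scaled_catalan n * \<y>) = scaled_catalan (Suc n) * \<y>"
    using shuffle_comm_xy_Cons[OF balanced_scaled_catalan, of n] shuffle_comm_xy_snoc[OF balanced_scaled_catalan, of n]
      central scaled_catalan_invariants[of n] by auto
  moreover have "shuffle_comm (scale a f) g = scale a (shuffle_comm f g)"
    "shuffle_comm f (scale a g) = scale a (shuffle_comm f g)" for a f g
    by (simp_all add: shuffle_comm_def shuffle_linear free_alg.scale_right_diff_distrib)
  ultimately show "\<phi> (E_alpha0 (Suc n)) = scale (c ^ Suc n) (\<x> * scaled_catalan (Suc n))"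
    and "\<phi> (E_alpha1 (Suc n)) = scale (c ^ Suc n) (scaled_catalan (Suc n) * \<y>)"
    by (simp_all only: E_alpha0.simps E_alpha1.simps phi_scale phi_super_comm_E_delta1 Suc
        free_alg.scale_scale flip: scale) (simp_all only: power_Suc mult_ac)
qed

theorem theorem18:
  shows "(\<forall>n.
      \<phi> (E_alpha0 n) =
        scale (\<q> powi (- 2 * int n) * (\<q> + inverse \<q>) ^ (2 * n)) (word [LX] * catalan_elem n) \<and>
      \<phi> (E_alpha1 n) =
        scale (\<q> powi (- 2 * int n) * (\<q> + inverse \<q>) ^ (2 * n)) (catalan_elem n * word [LY])) \<and>
    (\<forall>n\<ge>1.
      \<phi> (E_delta n) =
        scale (- (\<q> powi (- 2 * int n)) * (\<q> + inverse \<q>) ^ (2 * n - 1)) (catalan_elem n))"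
proof -
  define c where "c = \<q> powi (- 2) * (\<q> + inverse \<q>)"
  have coeff: "c ^ n * (\<q> + inverse \<q>) ^ n = \<q> powi (- 2 * int n) * (\<q> + inverse \<q>) ^ (2 * n)" for n
  proof -
    have "(\<q> powi (- 2)) ^ n = \<q> powi (- 2 * int n)"
      by (simp only: power_int_mult power_int_of_nat)
    then show ?thesis
      by (simp only: c_def power_mult_distrib mult_2 power_add mult.assoc)
  qed
  have alpha: "\<phi> (E_alpha0 n) =
        scale (\<q> powi (- 2 * int n) * (\<q> + inverse \<q>) ^ (2 * n)) (\<x> * catalan_elem n)"
      "\<phi> (E_alpha1 n) =
        scale (\<q> powi (- 2 * int n) * (\<q> + inverse \<q>) ^ (2 * n)) (catalan_elem n * \<y>)" for n
    by (simp_all only: phi_E_alpha_scaled_catalan c_def[symmetric] scaled_catalan_conv_catalan_elem scale_mult_left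
        scale_mult_right free_alg.scale_scale coeff)
  have delta: "\<phi> (E_delta (Suc m)) =
      scale (- (\<q> powi (- 2 * int (Suc m))) * (\<q> + inverse \<q>) ^ (2 * Suc m - 1))
        (catalan_elem (Suc m))" for m
  proof -
    (* Multiplication by - q^(-2), the inverse of the braiding parameter, turns the expression
       that defines grow_right into the one that defines E_delta. *)
    have s: "- (\<q> powi (- 2)) * \<s> = 1"
      by (simp add: braid_param_def power_int_minus)
    have "\<phi> (E_delta (Suc m)) =
        scale (c ^ m) (scale (\<q> powi (- 2)) ((scaled_catalan m * \<y>) \<star> \<x>) + \<x> \<star> (scaled_catalan m * \<y>))"
      by (simp add: E_delta_def phi_add phi_scale phi_mult phi_A phi_B phi_E_alpha_scaled_catalan(2)
          shuffle_linear free_alg.scale_right_distrib c_def mult_ac)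
    also have "\<dots> = scale (c ^ m) (scale (- (\<q> powi (- 2))) (scaled_catalan (Suc m)))"
      by (simp only: scaled_catalan.simps grow_right_def free_alg.scale_right_diff_distrib
          free_alg.scale_scale s) (simp add: free_alg.scale_right_distrib)
    also have "\<dots> = scale (- (\<q> powi (- 2)) * (c ^ m * (\<q> + inverse \<q>) ^ Suc m))
        (catalan_elem (Suc m))"
      by (simp only: scaled_catalan_conv_catalan_elem free_alg.scale_scale mult_ac)
    also have "- (\<q> powi (- 2)) * (c ^ m * (\<q> + inverse \<q>) ^ Suc m) =
        - (\<q> powi (- 2 * int (Suc m))) * (\<q> + inverse \<q>) ^ (2 * Suc m - 1)"
    proof -
      have "\<q> powi (- 2 * int (Suc m)) = \<q> powi (- 2) * \<q> powi (- 2 * int m)"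
        by (simp add: power_int_add[symmetric])
      moreover have "c ^ m * (\<q> + inverse \<q>) ^ Suc m =
          \<q> powi (- 2 * int m) * (\<q> + inverse \<q>) ^ (2 * Suc m - 1)"
        using coeff[of m] by (simp add: mult_ac)
      ultimately show ?thesis by simp
    qed
    finally show ?thesis .
  qed
  have "\<phi> (E_delta n) =
      scale (- (\<q> powi (- 2 * int n)) * (\<q> + inverse \<q>) ^ (2 * n - 1)) (catalan_elem n)"
    if "n \<ge> 1" for n
    using delta[of "n - 1"] that by simp
  with alpha show ?thesis by blast
qed

end
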